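(* Let $\mathbb{F}$ be a field, $E=\mathbb{F}^n$, and let $\mathcal{B}$ be the family of bases of a $q$-matroid with ground space $E$. Then $(E,\mathcal{B})$ is a $q$-$\Delta$-matroid.
   Context: $E=\mathbb{F}^n$ is a finite-dimensional vector space over a field $\mathbb{F}$. A $q$-matroid on $E$ is a pair $M=(E,r)$ with $r$ an integer-valued function on the subspaces of $E$ such that (R1) $0\le r(A)\le\dim A$ for every subspace $A$; (R2) $r(A)\le r(B)$ whenever $A\subseteq B$; (R3) $r(A+B)+r(A\cap B)\le r(A)+r(B)$ for all subspaces $A,B$. A subspace $A$ is independent if $r(A)=\dim A$; a basis is an inclusion-maximal independent subspace. Equivalently (known from earlier literature), a family $\mathcal{B}$ of subspaces of $E$ is the family of bases of a $q$-matroid iff: (B1) $\mathcal{B}\neq\emptyset$; (B2) for $B_1,B_2\in\mathcal{B}$, $B_1\subseteq B_2$ implies $B_1=B_2$; (nB3) for all $B_1,B_2\in\mathcal{B}$ and each subspace $A$ of codimension $1$ in $B_1$ there is $X\subseteq E$ of codimension $1$ in $E$ with $A\subseteq X$, $B_2\not\subseteq X$ and $A+x\in\mathcal{B}$ for all $1$-dimensional $x\subseteq E$, $x\not\subseteq X$. A $q$-$\Delta$-matroid is a pair $(E,\mathcal{F})$ with $\mathcal{F}$ a non-empty family of subspaces of $E$ satisfying: (F1) For all $X,Y\in\mathcal{F}$ and each subspace $A$ of codimension $1$ in $X$, either (i) there is a codimension-$1$ subspace $Z\subseteq E$ with $A\subseteq Z$, $Y\not\subseteq Z$, such that $A+z\in\mathcal{F}$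 for all $1$-dimensional $z\subseteq E$ with $z\not\subseteq Z$; or (ii) there is a codimension-$1$ subspace $Z\subseteq E$ such that $Z\cap A\in\mathcal{F}$. (F2) For all $X,Y\in\mathcal{F}$ and each subspace $A\subseteq E$ in which $X$ has codimension $1$, either (iii) there is a $1$-dimensional $z\subseteq A$, $z\not\subseteq Y$, such that $A\cap Z\in\mathcal{F}$ for every codimension-$1$ subspace $Z\subseteq E$ with $z\not\subseteq Z$; or (iv) there is a $1$-dimensional $z\subseteq E$ such that $A+z\in\mathcal{F}$. *)

theory Defs
  imports "HOL.Vector_Spaces" "HOL-Library.Set_Algebras"
begin

text \<open>
  The ground space \<open>E\<close> is the whole type \<open>'b\<close>, i.e. \<open>UNIV\<close>. The sum of subspaces is the elementwise \<open>A + B\<close> of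
  \<^theory>\<open>HOL-Library.Set_Algebras\<close>.
\<close>

context finite_dimensional_vector_space
begin

definition codim_one_in :: "'b set \<Rightarrow> 'b set \<Rightarrow> bool" where
  "codim_one_in A X \<longleftrightarrow> subspace A \<and> subspace X \<and> A \<subseteq> X \<and> dim X = dim A + 1"

abbreviation hyperplane :: "'b set \<Rightarrow> bool" where
  "hyperplane Z \<equiv> codim_one_in Z UNIV"

definition one_dimensional :: "'b set \<Rightarrow> bool" where
  "one_dimensional z \<longleftrightarrow> subspace z \<and> dim z = 1"

text \<open>Only the values of \<open>r\<close> on subspaces are meaningful; its values on other sets are arbitrary.\<close>

definition q_matroid :: "('b set \<Rightarrow> int) \<Rightarrow> bool" where
  "q_matroid r \<longleftrightarrow>
     (\<forall>A. subspace A \<longrightarrow> 0 \<le> r A \<and> r A \<le> int (dim A)) \<and>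
     (\<forall>A B. subspace A \<longrightarrow> subspace B \<longrightarrow> A \<subseteq> B \<longrightarrow> r A \<le> r B) \<and>
     (\<forall>A B. subspace A \<longrightarrow> subspace B \<longrightarrow> r (A + B) + r (A \<inter> B) \<le> r A + r B)"

text \<open>Independence of a subspace in a \<open>q\<close>-matroid, as opposed to linear independence of a set
  of vectors, which is called \<open>independent\<close> in this locale.\<close>

definition q_independent :: "('b set \<Rightarrow> int) \<Rightarrow> 'b set \<Rightarrow> bool" where
  "q_independent r A \<longleftrightarrow> subspace A \<and> r A = int (dim A)"

definition q_bases :: "('b set \<Rightarrow> int) \<Rightarrow> 'b set set" where
  "q_bases r = {B. q_independent r B \<and> (\<forall>A. q_independent r A \<longrightarrow> B \<subseteq> A \<longrightarrow> A = B)}"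

definition q_delta_F1 :: "'b set set \<Rightarrow> bool" where
  "q_delta_F1 \<F> \<longleftrightarrow>
     (\<forall>X\<in>\<F>. \<forall>Y\<in>\<F>. \<forall>A. codim_one_in A X \<longrightarrow>
        (\<exists>Z. hyperplane Z \<and> A \<subseteq> Z \<and> \<not> Y \<subseteq> Z \<and>
             (\<forall>z. one_dimensional z \<longrightarrow> \<not> z \<subseteq> Z \<longrightarrow> A + z \<in> \<F>)) \<or>
        (\<exists>Z. hyperplane Z \<and> Z \<inter> A \<in> \<F>))"

definition q_delta_F2 :: "'b set set \<Rightarrow> bool" where
  "q_delta_F2 \<F> \<longleftrightarrow>
     (\<forall>X\<in>\<F>. \<forall>Y\<in>\<F>. \<forall>A. codim_one_in X A \<longrightarrow>
        (\<exists>z. one_dimensional z \<and> z \<subseteq> A \<and> \<not> z \<subseteq> Y \<and>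
             (\<forall>Z. hyperplane Z \<longrightarrow> \<not> z \<subseteq> Z \<longrightarrow> A \<inter> Z \<in> \<F>)) \<or>
        (\<exists>z. one_dimensional z \<and> A + z \<in> \<F>))"

definition q_delta_matroid :: "'b set set \<Rightarrow> bool" where
  "q_delta_matroid \<F> \<longleftrightarrow>
     \<F> \<noteq> {} \<and> (\<forall>X\<in>\<F>. subspace X) \<and> q_delta_F1 \<F> \<and> q_delta_F2 \<F>"

end

end

theory Submission
  imports Defs
begin

text \<open>
  Bases are the independent spaces of dimension \<open>r E\<close>. For (F1), alternative (i) always holds: \<open>Z\<close> is
  any hyperplane that contains the closure of \<open>A\<close>, which has rank \<open>r E - 1\<close>, but not \<open>Y\<close>.
  For (F2), alternative (iii) always holds: the nullity \<open>dim - r\<close> is monotone and supermodular, and it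
  is \<open>1\<close> at \<open>A\<close>, so any two dependent subspaces of \<open>A\<close> meet in a dependent one, and a dependent
  subspace \<open>C\<close> of \<open>A\<close> of least dimension lies in all the others. Since \<open>C\<close> is dependent it is not
  contained in \<open>Y\<close>, and any line \<open>z \<subseteq> C\<close> outside \<open>Y\<close> works:
  if \<open>z\<close> is not in \<open>Z\<close> then \<open>A \<inter> Z\<close> does not contain \<open>C\<close>, hence is independent.
\<close>

context finite_dimensional_vector_space
begin

section \<open>Sums, hyperplanes and complements of subspaces\<close>

lemma subspace_set_plus:
  assumes "subspace S" "subspace T"
  shows "subspace (S + T)"
proof -
  have "S + T = {x + y |x y. x \<in> S \<and> y \<in> T}"
    by (auto simp: set_plus_def)
  then show ?thesis
    using subspace_sums[OF assms] by simp
qed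

lemma dim_set_plus_Int:
  assumes "subspace S" "subspace T"
  shows "dim (S + T) + dim (S \<inter> T) = dim S + dim T"
proof -
  have "S + T = {x + y |x y. x \<in> S \<and> y \<in> T}"
    by (auto simp: set_plus_def)
  then show ?thesis
    using dim_sums_Int[OF assms] by simp
qed

lemma subset_set_plus:
  assumes "subspace S" "subspace T"
  shows "S \<subseteq> S + T" "T \<subseteq> S + T"
proof -
  show "S \<subseteq> S + T"
    using set_plus_intro[OF _ subspace_0[OF assms(2)]] by fastforce
  show "T \<subseteq> S + T"
    using set_plus_intro[OF subspace_0[OF assms(1)]] by fastforce
qed

lemma set_plus_subset:
  "subspace U \<Longrightarrow> S \<subseteq> U \<Longrightarrow> T \<subseteq> U \<Longrightarrow> S + T \<subseteq> U"
  by (auto elim!: set_plus_elim intro: subspace_add)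

lemma dim_less_if_psubset:
  "subspace S \<Longrightarrow> subspace T \<Longrightarrow> S \<subset> T \<Longrightarrow> dim S < dim T"
  by (metis dim_psubset span_eq_iff)

lemma dim_set_plus_line:
  assumes S: "subspace S" and z: "one_dimensional z" "\<not> z \<subseteq> S"
  shows "dim (S + z) = dim S + 1"
proof -
  have sz: "subspace z" "dim z = 1"
    using z(1) by (auto simp: one_dimensional_def)
  have "dim (S \<inter> z) < dim z"
    using sz z(2) S by (intro dim_less_if_psubset subspace_inter) auto
  then have "dim (S \<inter> z) = 0"
    using sz(2) by linarith
  then show ?thesis
    using dim_set_plus_Int[OF S sz(1)] sz(2) by linarith
qed

lemma one_dimensional_span:
  "v \<noteq> 0 \<Longrightarrow> one_dimensional (span {v})"
  by (simp add: one_dimensional_def)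

text \<open>A basis of \<open>K\<close> together with \<open>y\<close> extends to a basis of the
  whole space; dropping \<open>y\<close> from it leaves a spanning set of the hyperplane.\<close>

lemma hyperplane_avoiding:
  assumes K: "subspace K" and y: "y \<notin> K"
  obtains Z where "hyperplane Z" "K \<subseteq> Z" "y \<notin> Z"
proof -
  obtain b where b: "independent b" "span b = K"
    using basis_subspace_exists[OF K] by metis
  have ind: "independent (insert y b)"
    using b y by (simp add: independent_insert)
  define c where "c = extend_basis (insert y b)"
  have c: "insert y b \<subseteq> c" "independent c" "span c = UNIV"
    using extend_basis_superset[OF ind] independent_extend_basis[OF ind] span_extend_basis[OF ind]
    by (auto simp: c_def)
  let ?Z = "span (c - {y})"
  have yZ: "y \<notin> ?Z"
    using c by (auto simp: dependent_def)
  have "dim UNIV = dim ?Z + 1"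
    using dim_insert[of y "c - {y}"] c yZ by (metis dim_span insert_Diff insert_subset)
  moreover have "b \<subseteq> c - {y}"
    using c b y span_base by blast
  then have "K \<subseteq> ?Z"
    using b(2) span_mono by blast
  ultimately show thesis
    using yZ by (intro that[of ?Z]) (simp_all add: codim_one_in_def del: dim_span)
qed

text \<open>A basis of \<open>J\<close> extends to one of \<open>I\<close>, and the added vectors
  span \<open>W\<close>.\<close>

lemma complement_in_subspace:
  assumes "subspace J" "subspace I" "J \<subseteq> I"
  obtains W where "subspace W" "J + W = I" "dim J + dim W = dim I"
proof -
  obtain b where b: "finite b" "b \<subseteq> J" "independent b" "span b = J" "card b = dim J"
    using basis_subspace_exists[OF assms(1)] by metis
  obtain c where c: "b \<subseteq> c" "c \<subseteq> I" "independent c" "I \<subseteq> span c"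
    using maximal_independent_subset_extend[of b I] b assms(3) by (metis subset_trans)
  have sc: "span c = I"
    using c assms(2) by (simp add: span_minimal subset_antisym)
  have "J + span (c - b) = span (b \<union> (c - b))"
    unfolding span_Un b(4) set_plus_def by blast
  then have sum: "J + span (c - b) = I"
    using c(1) sc by (simp add: Un_absorb1)
  have fc: "finite c"
    using c(3) by (rule finiteI_independent)
  have "dim (span (c - b)) = card (c - b)"
    using c(3) independent_mono[of c "c - b"] by (simp add: dim_span_eq_card_independent del: dim_span)
  moreover have "dim I = card c"
    using c(3) sc dim_span_eq_card_independent by blast
  moreover have "card (c - b) + card b = card c"
    using fc c(1) b(1) by (simp add: card_Diff_subset card_mono)
  ultimately show thesis
    using sum b(5) by (intro that[of "span (c - b)"]) simp_all
qed

section \<open>Rank, nullity, closure and bases\<close>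

context
  fixes r :: "'b set \<Rightarrow> int"
  assumes q_matroid: "q_matroid r"
begin

lemma rank_nonneg: "subspace A \<Longrightarrow> 0 \<le> r A"
  and rank_le_dim: "subspace A \<Longrightarrow> r A \<le> int (dim A)"
  and rank_mono: "subspace A \<Longrightarrow> subspace B \<Longrightarrow> A \<subseteq> B \<Longrightarrow> r A \<le> r B"
  and rank_submodular: "subspace A \<Longrightarrow> subspace B \<Longrightarrow> r (A + B) + r (A \<inter> B) \<le> r A + r B"
  using q_matroid by (auto simp: q_matroid_def)

text \<open>By submodularity, adding a complement \<open>W\<close> of \<open>S\<close> in
  \<open>A\<close> raises the rank by at most \<open>r W\<close>, hence by at most
  \<open>dim W\<close>, while the dimension rises by exactly \<open>dim W\<close>.\<close>

lemma nullity_mono: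
  assumes "subspace S" "subspace A" "S \<subseteq> A"
  shows "int (dim S) - r S \<le> int (dim A) - r A"
proof -
  obtain W where W: "subspace W" "S + W = A" "dim S + dim W = dim A"
    using complement_in_subspace[OF assms] .
  have "r A \<le> r S + r W"
    using rank_submodular[OF assms(1) W(1)] rank_nonneg[OF subspace_inter[OF assms(1) W(1)]] W(2)
    by simp
  then show ?thesis
    using W(3) rank_le_dim[OF W(1)] by linarith
qed

text \<open>Independence means nullity zero, and nullity is monotone and never negative.\<close>

lemma q_independent_subset:
  assumes "q_independent r I" "subspace J" "J \<subseteq> I"
  shows "q_independent r J"
  using assms nullity_mono[of J I] rank_le_dim[of J] by (simp add: q_independent_def)

text \<open>Take \<open>K\<close> of greatest dimension among the subspaces that contain
  \<open>A\<close> and have its rank. A line outside \<open>K\<close> that left the rank of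
  \<open>A\<close> unchanged could be added to \<open>K\<close> without raising its rank either,
  against the choice of \<open>K\<close>.\<close>

lemma closure_exists:
  assumes A: "subspace A"
  obtains K where "subspace K" "A \<subseteq> K" "r K = r A"
    "\<And>z. one_dimensional z \<Longrightarrow> \<not> z \<subseteq> K \<Longrightarrow> r A < r (A + z)"
proof -
  let ?P = "\<lambda>K. subspace K \<and> A \<subseteq> K \<and> r K = r A"
  have "\<exists>K. ?P K \<and> (\<forall>L. ?P L \<longrightarrow> dim L \<le> dim K)"
    using A by (intro ex_has_greatest_nat[of _ A _ "Suc (dim UNIV)"]) (auto simp: less_Suc_eq_le dim_subset simp del: dim_UNIV)
  then obtain K where K: "?P K" and max: "\<And>L. ?P L \<Longrightarrow> dim L \<le> dim K"
    by blast
  have "r A < r (A + z)" if z: "one_dimensional z" "\<not> z \<subseteq> K" for z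
  proof (rule ccontr)
    assume "\<not> r A < r (A + z)"
    moreover have sz: "subspace z"
      using z by (simp add: one_dimensional_def)
    note sAz = subspace_set_plus[OF A sz] and sKz = subspace_set_plus[OF _ sz, of K]
    ultimately have le: "r (A + z) \<le> r A" by simp
    have sub: "A \<subseteq> K \<inter> (A + z)"
      using K subset_set_plus[OF A sz] by blast
    \<comment> \<open>This identifies the sum in the submodular inequality for \<open>K\<close> and
      \<open>A + z\<close>; their intersection contains \<open>A\<close>, so its rank is at least
      \<open>r A\<close>.\<close>
    have "K + (A + z) = (K + A) + z"
      by (simp add: add.assoc)
    moreover have "K + A = K"
      using K A set_plus_subset[of K K A] subset_set_plus[of K A] by blast
    ultimately have eq: "K + (A + z) = K + z" by simp
    have "r A \<le> r (K \<inter> (A + z))"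
      using K A sAz sub by (intro rank_mono subspace_inter) auto
    then have "r (K + z) \<le> r A"
      using rank_submodular[of K "A + z"] K sAz eq le by simp
    moreover have Kz: "K \<subseteq> K + z"
      using K sz subset_set_plus by blast
    then have "r K \<le> r (K + z)"
      using K sKz by (intro rank_mono) auto
    ultimately have "?P (K + z)"
      using K sKz Kz by auto
    then show False
      using max[of "K + z"] dim_set_plus_line[OF _ z] K by simp
  qed
  then show thesis
    using that K by blast
qed

text \<open>A line adds at most 1 to the dimension, which bounds the rank; a strict rise in rank
  from \<open>r A = dim A\<close> therefore makes both rise by exactly 1.\<close>

lemma q_independent_extend:
  assumes A: "q_independent r A" and z: "one_dimensional z" and less: "r A < r (A + z)"
  shows "q_independent r (A + z)" "r (A + z) = r A + 1"
proof -
  have sA: "subspace A" and sz: "subspace z" and rA: "r A = int (dim A)"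
    using A z by (auto simp: q_independent_def one_dimensional_def)
  have s: "subspace (A + z)"
    using sA sz by (rule subspace_set_plus)
  have "dim (A + z) \<le> dim A + 1"
    using dim_set_plus_Int[OF sA sz] z by (simp add: one_dimensional_def)
  then have *: "r (A + z) = r A + 1" "r (A + z) = int (dim (A + z))"
    using rank_le_dim[OF s] less rA by linarith+
  show "q_independent r (A + z)" "r (A + z) = r A + 1"
    using * s by (auto simp: q_independent_def)
qed

text \<open>Maximality forbids any line to raise the rank of a basis, so its closure is the whole
  space. Conversely, \<open>r UNIV\<close> caps the dimension of every independent space.\<close>

lemma q_bases_iff:
  "B \<in> q_bases r \<longleftrightarrow> q_independent r B \<and> int (dim B) = r UNIV"
proof
  assume B: "B \<in> q_bases r"
  then have ind: "q_independent r B"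
    and max: "\<And>A. q_independent r A \<Longrightarrow> B \<subseteq> A \<Longrightarrow> A = B"
    by (auto simp: q_bases_def)
  have sB: "subspace B" and rB: "r B = int (dim B)"
    using ind by (auto simp: q_independent_def)
  obtain K where K: "subspace K" "r K = r B"
    and cl: "\<And>z. one_dimensional z \<Longrightarrow> \<not> z \<subseteq> K \<Longrightarrow> r B < r (B + z)"
    using closure_exists[OF sB] by metis
  have "v \<in> K" for v
  proof (rule ccontr)
    assume v: "v \<notin> K"
    then have "v \<noteq> 0"
      using K subspace_0 by blast
    then have z: "one_dimensional (span {v})"
      by (rule one_dimensional_span)
    have "\<not> span {v} \<subseteq> K"
      using v span_base[of v "{v}"] by blast
    then have less: "r B < r (B + span {v})"
      using cl[OF z] by simp
    then have "B + span {v} = B"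
      using max q_independent_extend(1)[OF ind z less] subset_set_plus(1)[OF sB, of "span {v}"] by simp
    then show False
      using less by simp
  qed
  then have "K = UNIV" by auto
  then show "q_independent r B \<and> int (dim B) = r UNIV"
    using ind rB K by simp
next
  assume B: "q_independent r B \<and> int (dim B) = r UNIV"
  have "A = B" if "q_independent r A" "B \<subseteq> A" for A
  proof -
    have "int (dim A) \<le> r UNIV"
      using that rank_mono[of A UNIV] by (auto simp: q_independent_def)
    then show ?thesis
      using that B subspace_dim_equal[of B A] by (auto simp: q_independent_def)
  qed
  then show "B \<in> q_bases r"
    using B by (auto simp: q_bases_def)
qed

lemma q_bases_nonempty: "q_bases r \<noteq> {}"
proof -
  have "q_independent r {0}"
    using rank_nonneg[of "{0}"] rank_le_dim[of "{0}"] by (auto simp: q_independent_def)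
  then have "\<exists>B. q_independent r B \<and> (\<forall>A. q_independent r A \<longrightarrow> dim A \<le> dim B)"
    by (intro ex_has_greatest_nat[of _ "{0}" _ "Suc (dim UNIV)"]) (auto simp: less_Suc_eq_le dim_subset simp del: dim_UNIV)
  then obtain B where B: "q_independent r B" "\<And>A. q_independent r A \<Longrightarrow> dim A \<le> dim B"
    by blast
  have "A = B" if "q_independent r A" "B \<subseteq> A" for A
    using that B subspace_dim_equal[of B A] by (auto simp: q_independent_def)
  then show ?thesis
    using B(1) by (auto simp: q_bases_def)
qed

section \<open>The two exchange properties\<close>

lemma q_bases_F1: "q_delta_F1 (q_bases r)"
  unfolding q_delta_F1_def
proof (intro ballI allI impI disjI1)
  fix X Y A
  assume X: "X \<in> q_bases r" and Y: "Y \<in> q_bases r" and "codim_one_in A X"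
  then have sA: "subspace A" and "A \<subseteq> X" and dX: "dim X = dim A + 1"
    by (auto simp: codim_one_in_def)
  then have A: "q_independent r A"
    using X q_independent_subset by (auto simp: q_bases_iff)
  have rA: "r A + 1 = r UNIV"
    using A X dX by (auto simp: q_bases_iff q_independent_def)
  obtain K where K: "subspace K" "A \<subseteq> K" "r K = r A"
    and cl: "\<And>z. one_dimensional z \<Longrightarrow> \<not> z \<subseteq> K \<Longrightarrow> r A < r (A + z)"
    using closure_exists[OF sA] by metis
  \<comment> \<open>\<open>Y\<close> has rank \<open>r UNIV\<close>, whereas \<open>K\<close> has
    rank one less.\<close>
  have "\<not> Y \<subseteq> K"
    using rank_mono[of Y K] Y K rA by (auto simp: q_bases_iff q_independent_def)
  then obtain y where "y \<in> Y" "y \<notin> K" by blast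
  then obtain Z where Z: "hyperplane Z" "K \<subseteq> Z" "y \<notin> Z"
    using hyperplane_avoiding K(1) by metis
  have "A + z \<in> q_bases r" if z: "one_dimensional z" "\<not> z \<subseteq> Z" for z
  proof -
    \<comment> \<open>A line outside \<open>Z\<close> is also outside \<open>K\<close>, so it lifts
      the rank of \<open>A\<close> to \<open>r UNIV\<close>.\<close>
    have "r A < r (A + z)"
      using cl z Z(2) by blast
    then show ?thesis
      using q_independent_extend[OF A z(1)] rA by (auto simp: q_bases_iff q_independent_def)
  qed
  then show "\<exists>Z. hyperplane Z \<and> A \<subseteq> Z \<and> \<not> Y \<subseteq> Z \<and>
      (\<forall>z. one_dimensional z \<longrightarrow> \<not> z \<subseteq> Z \<longrightarrow> A + z \<in> q_bases r)"
    using Z K \<open>y \<in> Y\<close> by blast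
qed

text \<open>By supermodularity, the nullities of \<open>S + T\<close> and
  \<open>S \<inter> T\<close> add up to at least those of \<open>S\<close> and \<open>T\<close>,
  which are at least 1 each. The sum accounts for at most 1, so the intersection has positive
  nullity.\<close>

lemma dependent_Int:
  assumes S: "subspace S" "\<not> q_independent r S" and T: "subspace T" "\<not> q_independent r T"
    and null: "int (dim (S + T)) \<le> r (S + T) + 1"
  shows "\<not> q_independent r (S \<inter> T)"
proof
  assume "q_independent r (S \<inter> T)"
  moreover have "r S < int (dim S)" "r T < int (dim T)"
    using S T rank_le_dim[of S] rank_le_dim[of T] by (auto simp: q_independent_def)
  ultimately show False
    using rank_submodular[OF S(1) T(1)] dim_set_plus_Int[OF S(1) T(1)] null
    by (simp add: q_independent_def)
qed

lemma q_bases_F2: "q_delta_F2 (q_bases r)"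
  unfolding q_delta_F2_def
proof (intro ballI allI impI disjI1)
  fix X Y A
  assume X: "X \<in> q_bases r" and Y: "Y \<in> q_bases r" and "codim_one_in X A"
  then have sX: "subspace X" and sA: "subspace A" and "X \<subseteq> A" and dA: "dim A = dim X + 1"
    by (auto simp: codim_one_in_def)
  \<comment> \<open>Since \<open>r X = r UNIV\<close>, the rank of \<open>A\<close> is squeezed, and
    its nullity is exactly 1.\<close>
  then have "r X \<le> r A" "r A \<le> r UNIV"
    by (simp_all add: rank_mono)
  then have rA: "r A = r UNIV" "int (dim A) = r A + 1"
    using X dA by (auto simp: q_bases_iff q_independent_def)
  let ?P = "\<lambda>C. subspace C \<and> C \<subseteq> A \<and> \<not> q_independent r C"
  have "?P A"
    using sA rA by (simp add: q_independent_def)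
  then obtain C where C: "?P C" and min: "\<And>D. ?P D \<Longrightarrow> dim C \<le> dim D"
    using ex_has_least_nat[of ?P A dim] by blast
  have "\<not> C \<subseteq> Y"
    using C Y q_independent_subset by (auto simp: q_bases_iff)
  then obtain v where v: "v \<in> C" "v \<notin> Y" by blast
  have "v \<noteq> 0"
    using v(2) Y subspace_0[of Y] by (auto simp: q_bases_iff q_independent_def)
  then have one: "one_dimensional (span {v})"
    by (rule one_dimensional_span)
  have zA: "span {v} \<subseteq> A"
    using C v sA by (intro span_minimal) auto
  have basis: "A \<inter> Z \<in> q_bases r" if Z: "hyperplane Z" "\<not> span {v} \<subseteq> Z" for Z
  proof -
    have sZ: "subspace Z" and dZ: "dim (UNIV :: 'b set) = dim Z + 1"
      using Z(1) unfolding codim_one_in_def by blast+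
    have vZ: "v \<notin> Z"
      using Z(2) sZ span_minimal[of "{v}" Z] by blast
    have sAZ: "subspace (A \<inter> Z)"
      using sA sZ by (rule subspace_inter)
    have ind: "q_independent r (A \<inter> Z)"
    proof (rule ccontr)
      assume dep: "\<not> q_independent r (A \<inter> Z)"
      let ?D = "C \<inter> (A \<inter> Z)"
      \<comment> \<open>Inside \<open>A\<close> the sum inherits nullity at most 1, the bound that
        \<open>dependent_Int\<close> asks for.\<close>
      have "C + (A \<inter> Z) \<subseteq> A"
        using sA C by (intro set_plus_subset) auto
      then have "int (dim (C + (A \<inter> Z))) \<le> r (C + (A \<inter> Z)) + 1"
        using nullity_mono[of "C + (A \<inter> Z)" A] subspace_set_plus[of C "A \<inter> Z"] C sAZ sA rA by simp
      then have "?P ?D"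
        using dependent_Int[of C "A \<inter> Z"] C sAZ dep by (auto intro: subspace_inter)
      \<comment> \<open>The vector \<open>v\<close> lies in \<open>C\<close> but not in
        \<open>Z\<close>, so the inclusion in \<open>C\<close> is strict.\<close>
      moreover have "dim ?D < dim C"
        using C v(1) vZ sA sZ by (intro dim_less_if_psubset subspace_inter) auto
      ultimately show False
        using min[of ?D] by simp
    qed
    \<comment> \<open>Hence a hyperplane cuts the dimension of \<open>A\<close> by at most 1, down
      to no less than \<open>r UNIV\<close>.\<close>
    have "dim (A + Z) \<le> dim Z + 1"
      using dim_subset[OF subset_UNIV, of "A + Z"] dZ by linarith
    then have "int (dim (A \<inter> Z)) \<ge> r UNIV"
      using dim_set_plus_Int[OF sA sZ] rA by linarith
    moreover have "r (A \<inter> Z) \<le> r UNIV"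
      using sAZ by (simp add: rank_mono)
    ultimately show ?thesis
      using ind by (auto simp: q_bases_iff q_independent_def)
  qed
  have "\<not> span {v} \<subseteq> Y"
    using v(2) span_base[of v "{v}"] by blast
  then show "\<exists>z. one_dimensional z \<and> z \<subseteq> A \<and> \<not> z \<subseteq> Y \<and>
      (\<forall>Z. hyperplane Z \<longrightarrow> \<not> z \<subseteq> Z \<longrightarrow> A \<inter> Z \<in> q_bases r)"
    using one zA basis by blast
qed

lemma q_delta_matroid_q_bases: "q_delta_matroid (q_bases r)"
  using q_bases_nonempty q_bases_F1 q_bases_F2
  by (auto simp: q_delta_matroid_def q_bases_iff q_independent_def)

end

end

theorem proposition3p3:
  fixes scale :: "'a::field \<Rightarrow> 'b::ab_group_add \<Rightarrow> 'b"
    and Basis :: "'b set"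
    and r :: "'b set \<Rightarrow> int"
  assumes "finite_dimensional_vector_space scale Basis"
    and "finite_dimensional_vector_space.q_matroid scale r"
  shows "finite_dimensional_vector_space.q_delta_matroid scale (finite_dimensional_vector_space.q_bases scale r)"
  using finite_dimensional_vector_space.q_delta_matroid_q_bases[OF assms] .

end
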